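(* Let $n,d\ge1$, $\lambda>0$, $\sigma^2>0$, let $\Sigma\in\mathbb{R}^{d\times d}$ be a covariance matrix with eigenvalue-eigenvector pairs $(\tau_j,v_j)_{1\le j\le d}$ ($v_1,\dots,v_d$ orthonormal), and let $\beta^\star\in\mathbb{R}^d$ be deterministic, with $\beta_j=\langle\beta^\star,v_j\rangle$. Let $\Phi:\mathbb{R}^+\to\mathbb{R}$ be a function such that, for every $\tau\in\{\tau_1,\dots,\tau_d\}$, $$\Phi(\tau)=\frac{d}{|J(\tau)|}\sum_{j\in J(\tau)}\beta_j^2,\qquad J(\tau)=\{1\le j\le d:\tau_j=\tau\}.$$ Let $\Pi$ be a distribution on $\mathbb{R}^d$ such that $\mathbf E_{\beta\sim\Pi}[\beta]=0$ and $\mathbf E_{\beta\sim\Pi}[\beta\beta^\top]=\Phi(\Sigma)/d$. Then $$\mathbf E_{X,\epsilon}\big[\|\Sigma^{1/2}(\widehat\beta_\lambda-\beta^\star)\|_2^2\big]=\mathbf E_{\beta\sim\Pi}\,\mathbf E_{X,\epsilon}\big[\|\Sigma^{1/2}(\widehat\beta_\lambda-\beta)\|_2^2\big],$$ where on the left $\widehat\beta_\lambda$ is the ridge estimator computed from data generated with true parameter $\beta^\star$, and on the right from data generated with true parameter $\beta$ (with $\beta\sim\Pi$ independent of $X,\epsilon$).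
   Context: Data with true parameter $b\in\mathbb{R}^d$: $n$ i.i.d. samples $(x_i,y_i)$ with $y_i=\langle b,x_i\rangle+\sigma\epsilon_i$, $x_i\sim\mathcal N(0,\Sigma)$, $\mathbf E[\epsilon_i|x_i]=0$, $\mathbf E[\epsilon_i^2|x_i]=1$. $X\in\mathbb{R}^{n\times d}$ is the design matrix with rows $x_i^\top$, $Y=(y_1,\dots,y_n)$, $\epsilon=(\epsilon_1,\dots,\epsilon_n)$. The ridge estimator is $\widehat\beta_\lambda=\big(\frac{X^\top X}{n}+\lambda I\big)^{-1}\frac{X^\top Y}{n}$. $\Phi(\Sigma)=\sum_{j=1}^d\Phi(\tau_j)v_jv_j^\top$. $\mathbf E_{X,\epsilon}$ is expectation over covariates and noise for a fixed true parameter. *)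

theory Defs
  imports "HOL-Probability.Probability"
begin

definition pos_semidef :: "real^'d^'d \<Rightarrow> bool" where
  "pos_semidef A \<longleftrightarrow> transpose A = A \<and> (\<forall>u. 0 \<le> u \<bullet> (A *v u))"

(* The principal square root; it exists and is unique for positive semidefinite A
   (see mat_sqrt_eq_spectral_fun below) and carries no information otherwise. *)
definition mat_sqrt :: "real^'d^'d \<Rightarrow> real^'d^'d" where
  "mat_sqrt A = (THE R. pos_semidef R \<and> R ** R = A)"

(* u u^T *)
definition outer :: "real^'d \<Rightarrow> real^'d^'d" where
  "outer u = (columnvector u :: real^1^'d) ** (rowvector u :: real^'d^1)"

definition orthonormal_family :: "('d::finite \<Rightarrow> real^'d) \<Rightarrow> bool" where
  "orthonormal_family v \<longleftrightarrow> (\<forall>j k. v j \<bullet> v k = (if j = k then 1 else 0))"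

(* f(S) for the matrix S with eigenpairs (tau j, v j), v orthonormal *)
definition spectral_fun :: "(real \<Rightarrow> real) \<Rightarrow> ('d::finite \<Rightarrow> real) \<Rightarrow> ('d \<Rightarrow> real^'d) \<Rightarrow> real^'d^'d" where
  "spectral_fun f \<tau> v = (\<Sum>j\<in>UNIV. f (\<tau> j) *\<^sub>R outer (v j))"

definition std_gaussian :: "(real^'d) measure" where
  "std_gaussian = density lborel (\<lambda>z. ennreal (\<Prod>i\<in>UNIV. std_normal_density (z $ i)))"

(* N(0, S) as the law of S^(1/2) Z with Z ~ N(0, I), so that singular S is covered as well *)
definition gaussian :: "real^'d^'d \<Rightarrow> (real^'d) measure" where
  "gaussian S = distr std_gaussian borel (\<lambda>z. mat_sqrt S *v z)"

definition ridge_estimator :: "real \<Rightarrow> real^'d^'n \<Rightarrow> real^'n \<Rightarrow> real^'d" where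
  "ridge_estimator lam X Y =
     matrix_inv ((1 / real CARD('n)) *\<^sub>R (transpose X ** X) + lam *\<^sub>R mat 1)
       *v ((1 / real CARD('n)) *\<^sub>R (transpose X *v Y))"

definition design :: "('n::finite \<Rightarrow> 'w \<Rightarrow> real^'d) \<Rightarrow> 'w \<Rightarrow> real^'d^'n" where
  "design x \<omega> = (\<chi> i. x i \<omega>)"

definition response ::
  "real \<Rightarrow> ('n::finite \<Rightarrow> 'w \<Rightarrow> real^'d) \<Rightarrow> ('n \<Rightarrow> 'w \<Rightarrow> real) \<Rightarrow> real^'d \<Rightarrow> 'w \<Rightarrow> real^'n" where
  "response \<sigma> x \<epsilon> b \<omega> = (\<chi> i. b \<bullet> x i \<omega> + \<sigma> * \<epsilon> i \<omega>)"

(* The risk for the true parameter b, as an expectation with values in [0, \<infinity>]: the integrand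
   is nonnegative, and no integrability convention enters. *)
definition ridge_risk ::
  "'w measure \<Rightarrow> ('n::finite \<Rightarrow> 'w \<Rightarrow> real^'d) \<Rightarrow> ('n \<Rightarrow> 'w \<Rightarrow> real) \<Rightarrow> real^'d^'d \<Rightarrow> real \<Rightarrow> real
    \<Rightarrow> real^'d \<Rightarrow> ennreal" where
  "ridge_risk M x \<epsilon> S \<sigma> lam b =
     (\<integral>\<^sup>+\<omega>. ennreal ((norm (mat_sqrt S *v
         (ridge_estimator lam (design x \<omega>) (response \<sigma> x \<epsilon> b \<omega>) - b)))\<^sup>2) \<partial>M)"

lemma outer_mult_vec: "outer u *v w = (u \<bullet> w) *\<^sub>R u"
  by (simp add: outer_def vec_eq_iff matrix_vector_mult_def matrix_matrix_mult_def columnvector_def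
      rowvector_def inner_vec_def sum_distrib_left sum_distrib_right mult_ac)

lemma spectral_fun_mult_vec:
  "spectral_fun f \<tau> v *v w = (\<Sum>j\<in>UNIV. (f (\<tau> j) * (v j \<bullet> w)) *\<^sub>R v j)"
proof -
  have "(\<Sum>j\<in>J. f (\<tau> j) *\<^sub>R outer (v j)) *v w = (\<Sum>j\<in>J. (f (\<tau> j) * (v j \<bullet> w)) *\<^sub>R v j)"
    if "finite J" for J
    using that by induction
      (simp_all add: matrix_vector_mult_add_rdistrib outer_mult_vec scaleR_matrix_vector_assoc[symmetric])
  then show ?thesis by (simp add: spectral_fun_def)
qed

lemma orthonormal_expand:
  assumes "orthonormal_family v"
  shows "(\<Sum>j\<in>UNIV. (v j \<bullet> w) *\<^sub>R v j) = w"
proof -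
  let ?V = "\<chi> j. v j"
  have "?V ** transpose ?V = mat 1"
    using assms by (simp add: orthonormal_family_def vec_eq_iff matrix_matrix_mult_def transpose_def
        mat_def inner_vec_def)
  then have "transpose ?V ** ?V = mat 1" by (simp add: matrix_left_right_inverse)
  then have "transpose ?V *v (?V *v w) = w" by (simp add: matrix_vector_mul_assoc)
  then show ?thesis
    by (simp add: vec_eq_iff matrix_vector_mult_def transpose_def inner_vec_def mult.commute)
qed

lemma spectral_fun_eigvec:
  assumes "orthonormal_family v"
  shows "spectral_fun f \<tau> v *v v k = f (\<tau> k) *\<^sub>R v k"
proof -
  have "spectral_fun f \<tau> v *v v k = (\<Sum>j\<in>UNIV. if j = k then f (\<tau> k) *\<^sub>R v k else 0)"
    unfolding spectral_fun_mult_vec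
    using assms by (intro sum.cong) (auto simp: orthonormal_family_def)
  then show ?thesis by simp
qed

lemma matrix_eq_on_orthonormal:
  fixes A B :: "real^'d^'d"
  assumes "orthonormal_family v" "\<And>j. A *v v j = B *v v j"
  shows "A = B"
proof -
  have "A *v w = B *v w" for w
  proof -
    have "A *v w = A *v (\<Sum>j\<in>UNIV. (v j \<bullet> w) *\<^sub>R v j)"
      by (simp add: orthonormal_expand[OF assms(1)])
    also have "\<dots> = B *v (\<Sum>j\<in>UNIV. (v j \<bullet> w) *\<^sub>R v j)"
      by (simp add: linear_sum[OF matrix_vector_mul_linear] matrix_vector_mult_scaleR assms(2))
    finally show ?thesis by (simp add: orthonormal_expand[OF assms(1)])
  qed
  then show ?thesis by (simp add: matrix_eq)
qed

lemma mat_sqrt_eq_spectral_fun: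
  fixes S :: "real^'d^'d"
  assumes psd: "pos_semidef S" and orth: "orthonormal_family v"
    and eig: "\<And>j. S *v v j = \<tau> j *\<^sub>R v j"
  shows "mat_sqrt S = spectral_fun sqrt \<tau> v"
    and "pos_semidef (mat_sqrt S)" and "mat_sqrt S ** mat_sqrt S = S"
proof -
  let ?R = "spectral_fun sqrt \<tau> v"
  have n1: "v j \<bullet> v j = 1" for j using orth by (simp add: orthonormal_family_def)
  have tau: "0 \<le> \<tau> j" for j
  proof -
    have "0 \<le> v j \<bullet> (S *v v j)" using psd by (simp add: pos_semidef_def)
    then show ?thesis by (simp add: eig n1)
  qed
  have R_psd: "pos_semidef ?R"
    unfolding pos_semidef_def
  proof (intro conjI allI)
    show "transpose ?R = ?R"
      by (simp add: spectral_fun_def outer_def vec_eq_iff transpose_def matrix_matrix_mult_def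
          columnvector_def rowvector_def mult_ac)
    show "0 \<le> u \<bullet> (?R *v u)" for u
    proof -
      have "u \<bullet> (?R *v u) = (\<Sum>j\<in>UNIV. sqrt (\<tau> j) * (v j \<bullet> u)\<^sup>2)"
        by (simp add: spectral_fun_mult_vec inner_sum_right inner_commute power2_eq_square mult.assoc)
      also have "0 \<le> \<dots>" by (intro sum_nonneg) (simp add: tau)
      finally show ?thesis .
    qed
  qed
  have R_sq: "?R ** ?R = S"
    using orth
  proof (rule matrix_eq_on_orthonormal)
    show "(?R ** ?R) *v v j = S *v v j" for j
      by (simp add: matrix_vector_mul_assoc[symmetric] spectral_fun_eigvec[OF orth]
          matrix_vector_mult_scaleR eig tau)
  qed
  have uniq: "Q = ?R" if Q: "pos_semidef Q" "Q ** Q = S" for Q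
    using orth
  proof (rule matrix_eq_on_orthonormal)
    fix j
    define w where "w = Q *v v j - sqrt (\<tau> j) *\<^sub>R v j"
    have Qsym: "a \<bullet> (Q *v b) = (Q *v a) \<bullet> b" for a b
      using Q(1) dot_lmul_matrix[of a Q b] transpose_matrix_vector[of Q a]
      by (simp add: pos_semidef_def)
    have QQ: "Q *v (Q *v v j) = \<tau> j *\<^sub>R v j"
      using Q(2) eig[of j] by (simp add: matrix_vector_mul_assoc)
    have Qw: "Q *v w = - sqrt (\<tau> j) *\<^sub>R w"
      by (simp add: w_def matrix_vector_mult_diff_distrib matrix_vector_mult_scaleR QQ tau
          scaleR_diff_right)
    have "0 \<le> w \<bullet> (Q *v w)" using Q(1) by (simp add: pos_semidef_def)
    then have le: "sqrt (\<tau> j) * (w \<bullet> w) \<le> 0" by (simp add: Qw)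
    have "w = 0"
    proof (cases "\<tau> j = 0")
      case True
      then have "w \<bullet> w = v j \<bullet> (Q *v (Q *v v j))"
        using Qsym[of "v j" "Q *v v j"] by (simp add: w_def)
      then show ?thesis by (simp add: QQ True)
    next
      case False
      then have "0 < sqrt (\<tau> j)" using tau[of j] by simp
      then have "w \<bullet> w \<le> 0" using le by (simp add: mult_le_0_iff)
      then show ?thesis using inner_ge_zero[of w] by (metis antisym inner_eq_zero_iff)
    qed
    then show "Q *v v j = ?R *v v j" by (simp add: w_def spectral_fun_eigvec[OF orth])
  qed
  show "mat_sqrt S = ?R"
    unfolding mat_sqrt_def by (rule the_equality) (use R_psd R_sq in blast, use uniq in blast)
  then show "pos_semidef (mat_sqrt S)" "mat_sqrt S ** mat_sqrt S = S"
    using R_psd R_sq by simp_all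
qed

end

theory Submission
  imports Defs
begin

text \<open>
  Write \<open>R\<close> for the square root of \<open>S\<close> and \<open>G\<close> for the inverse of \<open>X\<^sup>T X / n + lam I\<close>. The error of the ridge
  estimator for the parameter \<open>b\<close> is \<open>- lam G b + \<sigma> G X\<^sup>T \<epsilon> / n\<close> (\<open>ridge_estimator_error\<close>). The noise has conditional
  mean zero and the samples are independent, so the cross term of the squared error has mean zero
  (\<open>integral_noise_times_design\<close>), and the risk is \<open>lam\<^sup>2 B b b + c\<close> with
  \<open>B a b = E ((R G a) \<bullet> (R G b))\<close> and a finite constant \<open>c\<close> independent of \<open>b\<close> (\<open>ridge_risk_eq\<close>).

  It remains to compare \<open>B \<beta>star \<beta>star\<close> with the mean of \<open>B \<beta> \<beta>\<close> under the prior, and this is a matter of symmetry. The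
  Gaussian law of the covariates is invariant under every isometry that commutes with \<open>R\<close>, hence so is \<open>B\<close>
  (\<open>bias_form_orthogonal\<close>). Reflections along eigenvectors of \<open>S\<close> are such isometries; they force \<open>B\<close> to be
  diagonal in the eigenbasis, with entries \<open>a j\<close> that depend on the eigenvalue only (\<open>bias_form_eigenvectors\<close>). Thus
  \<open>B b b\<close> is the sum of the \<open>a j (v j \<bullet> b)\<^sup>2\<close>. The prior replaces \<open>(v j \<bullet> \<beta>star)\<^sup>2\<close> by its
  average over the eigenspace, which the sum does not notice because \<open>a\<close> is constant there
  (\<open>sum_mult_fiber_average\<close>).

  Gaussian invariance rests on the invariance of Lebesgue measure under isometries (\<open>distr_lborel_orthogonal\<close>),
  which follows from translation invariance by a Fubini argument.
\<close>

section \<open>Isometries and Gaussian measures\<close>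

text \<open>The uniqueness proof for Haar measure, specialised to a comparison of \<^const>\<open>lborel\<close> with its
  image under \<open>T\<close>. Both measures are translation invariant, so integrating
  \<open>1\<^sub>D (T z) 1\<^sub>B (y)\<close> over \<open>(y, z)\<close> and shifting first \<open>y\<close> by \<open>- T z\<close>, then \<open>z\<close> by the
  preimage of \<open>y\<close>, exchanges their roles. Taking for \<open>B\<close> the unit ball, which \<open>- T\<close> preserves, makes
  the constant of proportionality \<open>1\<close>.\<close>
lemma distr_lborel_orthogonal:
  fixes T :: "'a::euclidean_space \<Rightarrow> 'a"
  assumes T: "orthogonal_transformation T"
  shows "distr lborel borel T = lborel"
proof (rule measure_eqI)
  show "sets (distr lborel borel T) = sets lborel" by simp
  have lin: "linear T" and iso: "\<And>z. norm (T z) = norm z"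
    using T by (simp_all add: orthogonal_transformation_linear orthogonal_transformation_norm)
  have [measurable]: "T \<in> borel_measurable borel"
    using lin by (simp add: borel_measurable_continuous_onI linear_continuous_on
        linear_conv_bounded_linear[symmetric])
  have shift: "(\<integral>\<^sup>+z. f (z + c) \<partial>lborel) = (\<integral>\<^sup>+z. f z \<partial>lborel)"
    if [measurable]: "f \<in> borel_measurable borel" for f :: "'a \<Rightarrow> ennreal" and c
  proof -
    have "(\<integral>\<^sup>+z. f z \<partial>lborel) = (\<integral>\<^sup>+z. f z \<partial>distr lborel borel ((+) c))"
      by (simp add: lborel_distr_plus)
    also have "\<dots> = (\<integral>\<^sup>+z. f (c + z) \<partial>lborel)" by (rule nn_integral_distr) auto
    finally show ?thesis by (simp add: add.commute)
  qed
  fix D :: "'a set" assume "D \<in> sets (distr lborel borel T)"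
  then have [measurable]: "D \<in> sets borel" by simp
  define B where "B = ball (0::'a) 1"
  have [measurable]: "B \<in> sets borel" by (simp add: B_def)
  have ballT: "indicator B (- T z) = (indicator B z :: ennreal)" for z
    by (simp add: B_def indicator_def iso)
  have "emeasure (distr lborel borel T) D * emeasure lborel B
      = (\<integral>\<^sup>+z. indicator D (T z) * emeasure lborel B \<partial>lborel)"
    by (simp add: nn_integral_multc nn_integral_distr[of T lborel borel "indicator D", simplified])
  \<comment> \<open>translation of \<open>y\<close> by \<open>- T z\<close>, which couples the two variables\<close>
  also have "\<dots> = (\<integral>\<^sup>+z. indicator D (T z) * (\<integral>\<^sup>+y. indicator B (y + (- T z)) \<partial>lborel) \<partial>lborel)"
    by (subst shift) auto
  also have "\<dots> = (\<integral>\<^sup>+z. (\<integral>\<^sup>+y. indicator D (T z) * indicator B (y - T z) \<partial>lborel) \<partial>lborel)"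
    by (simp add: nn_integral_cmult)
  also have "\<dots> = (\<integral>\<^sup>+y. (\<integral>\<^sup>+z. indicator D (T z) * indicator B (y - T z) \<partial>lborel) \<partial>lborel)"
    by (rule lborel_pair.Fubini'[symmetric]) simp
  \<comment> \<open>translation of \<open>z\<close> by \<open>c\<close> with \<open>T c = y\<close>, which decouples them with the roles exchanged\<close>
  also have "\<dots> = (\<integral>\<^sup>+y. (\<integral>\<^sup>+z. indicator D (y + T z) * indicator B z \<partial>lborel) \<partial>lborel)"
  proof (rule nn_integral_cong)
    fix y
    obtain c where c: "y = T c" using orthogonal_transformation_surj[OF T] by (metis surjD)
    have "(\<integral>\<^sup>+z. indicator D (T z) * indicator B (y - T z) \<partial>lborel)
        = (\<integral>\<^sup>+z. indicator D (T (z + c)) * indicator B (y - T (z + c)) \<partial>lborel)"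
      by (rule shift[symmetric]) simp
    also have "\<dots> = (\<integral>\<^sup>+z. indicator D (y + T z) * indicator B z \<partial>lborel)"
      by (simp add: linear_add[OF lin] c[symmetric] ballT add.commute)
    finally show "(\<integral>\<^sup>+z. indicator D (T z) * indicator B (y - T z) \<partial>lborel)
        = (\<integral>\<^sup>+z. indicator D (y + T z) * indicator B z \<partial>lborel)" .
  qed
  also have "\<dots> = (\<integral>\<^sup>+z. (\<integral>\<^sup>+y. indicator D (y + T z) * indicator B z \<partial>lborel) \<partial>lborel)"
    by (rule lborel_pair.Fubini') simp
  also have "\<dots> = emeasure lborel D * emeasure lborel B"
    by (simp add: nn_integral_multc shift nn_integral_cmult)
  finally have eq: "emeasure (distr lborel borel T) D * emeasure lborel B
      = emeasure lborel D * emeasure lborel B" .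
  have "emeasure lborel B \<noteq> 0"
    using open_not_negligible[of B] by (auto simp: B_def negligible_iff_emeasure0)
  moreover have "emeasure lborel B \<noteq> \<infinity>"
    using emeasure_bounded_finite[of B] by (simp add: B_def)
  ultimately show "emeasure (distr lborel borel T) D = emeasure lborel D"
    using eq by (simp add: mult.commute[of _ "emeasure lborel B"] ennreal_mult_cancel_left)
qed

lemma prod_std_normal_density:
  fixes z :: "real^'d"
  shows "(\<Prod>i\<in>UNIV. std_normal_density (z $ i))
     = (1 / sqrt (2 * pi)) ^ CARD('d) * exp (- (norm z)\<^sup>2 / 2)"
proof -
  have "(norm z)\<^sup>2 = (\<Sum>i\<in>UNIV. (z $ i)\<^sup>2)"
    by (simp add: power2_norm_eq_inner inner_vec_def power2_eq_square[of "_ $ _"])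
  then show ?thesis
    by (simp add: std_normal_density_def prod.distrib power_one_over prod_dividef exp_sum[symmetric]
        sum_negf sum_divide_distrib del: real_sqrt_mult)
qed

text \<open>The density depends on \<open>z\<close> only through its norm, and Lebesgue measure is invariant.\<close>
lemma distr_std_gaussian_orthogonal:
  fixes T :: "real^'d \<Rightarrow> real^'d"
  assumes T: "orthogonal_transformation T"
  shows "distr std_gaussian borel T = std_gaussian"
proof (rule measure_eqI)
  show "sets (distr std_gaussian borel T) = sets std_gaussian" by (simp add: std_gaussian_def)
  have iso: "\<And>z. norm (T z) = norm z"
    using T by (simp add: orthogonal_transformation_norm)
  have [measurable]: "T \<in> borel_measurable borel"
    using T by (simp add: orthogonal_transformation_linear
        borel_measurable_continuous_onI linear_continuous_on linear_conv_bounded_linear[symmetric])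
  fix D :: "(real^'d) set" assume "D \<in> sets (distr std_gaussian borel T)"
  then have [measurable]: "D \<in> sets borel" by simp
  define f where "f z = ennreal (\<Prod>i\<in>UNIV. std_normal_density (z $ i))" for z :: "real^'d"
  have [measurable]: "f \<in> borel_measurable borel"
    unfolding f_def prod_std_normal_density by measurable
  have fT: "f (T z) = f z" for z by (simp add: f_def prod_std_normal_density iso)
  have std: "std_gaussian = density lborel f" by (simp add: std_gaussian_def f_def[abs_def])
  have "emeasure (distr std_gaussian borel T) D
      = (\<integral>\<^sup>+z. indicator D z \<partial>distr (density lborel f) borel T)"
    by (simp add: std)
  also have "\<dots> = (\<integral>\<^sup>+z. indicator D (T z) \<partial>density lborel f)"
    by (rule nn_integral_distr) auto
  also have "\<dots> = (\<integral>\<^sup>+z. f (T z) * indicator D (T z) \<partial>lborel)"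
    by (subst nn_integral_density) (auto simp: fT)
  also have "\<dots> = (\<integral>\<^sup>+z. f z * indicator D z \<partial>distr lborel borel T)"
    by (rule nn_integral_distr[symmetric]) auto
  also have "\<dots> = emeasure std_gaussian D"
    by (simp add: distr_lborel_orthogonal[OF T] std emeasure_density)
  finally show "emeasure (distr std_gaussian borel T) D = emeasure std_gaussian D" .
qed

text \<open>The Gaussian is the image of the standard one under the square root of \<open>S\<close>; an isometry that commutes
  with the square root can be moved inside and absorbed there.\<close>
lemma distr_gaussian_orthogonal:
  fixes S :: "real^'d^'d"
  assumes T: "orthogonal_transformation T"
    and comm: "\<And>z. T (mat_sqrt S *v z) = mat_sqrt S *v T z"
  shows "distr (gaussian S) borel T = gaussian S"
proof -
  have [measurable]: "T \<in> borel_measurable borel"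
    using T by (simp add: orthogonal_transformation_linear
        borel_measurable_continuous_onI linear_continuous_on linear_conv_bounded_linear[symmetric])
  have [measurable]: "(\<lambda>z. mat_sqrt S *v z) \<in> borel_measurable borel"
    by (intro borel_measurable_continuous_onI linear_continuous_on matrix_vector_mul_bounded_linear)
  have [measurable_cong]: "sets std_gaussian = sets (borel :: (real^'d) measure)"
    by (simp add: std_gaussian_def)
  have "distr (gaussian S) borel T = distr std_gaussian borel (\<lambda>z. mat_sqrt S *v T z)"
    unfolding gaussian_def by (subst distr_distr) (auto simp: comp_def comm)
  also have "\<dots> = distr (distr std_gaussian borel T) borel (\<lambda>z. mat_sqrt S *v z)"
    by (subst distr_distr) (auto simp: comp_def)
  finally show ?thesis
    by (simp add: distr_std_gaussian_orthogonal[OF T] gaussian_def)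
qed

text \<open>The Householder reflection in the hyperplane orthogonal to \<open>u\<close>; the identity when \<open>u = 0\<close>,
  since then the quotient is \<open>0\<close>.\<close>
definition reflection :: "'a::real_inner \<Rightarrow> 'a \<Rightarrow> 'a" where
  "reflection u w = w - (2 * (u \<bullet> w) / (u \<bullet> u)) *\<^sub>R u"

lemma orthogonal_transformation_reflection: "orthogonal_transformation (reflection u)"
  unfolding orthogonal_transformation_def
proof (intro conjI allI)
  show "linear (reflection u)"
    by (intro linearI) (simp_all add: reflection_def inner_add_right algebra_simps add_divide_distrib)
  show "reflection u a \<bullet> reflection u b = a \<bullet> b" for a b
  proof (cases "u = 0")
    case False
    then show ?thesis
      by (simp add: reflection_def inner_diff_left inner_diff_right inner_commute field_simps)
  qed (simp add: reflection_def)
qed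

text \<open>A symmetric matrix maps both the line of an eigenvector and its orthogonal complement into themselves.\<close>
lemma reflection_commute:
  fixes R :: "real^'d^'d"
  assumes "transpose R = R" and "R *v u = s *\<^sub>R u"
  shows "reflection u (R *v z) = R *v reflection u z"
proof -
  have "u \<bullet> (R *v z) = s * (u \<bullet> z)"
    using assms by (metis dot_lmul_matrix inner_scaleR_left transpose_matrix_vector)
  then show ?thesis
    by (simp add: reflection_def matrix_vector_mult_diff_distrib matrix_vector_mult_scaleR assms(2))
qed

section \<open>The ridge resolvent\<close>

text \<open>The resolvent \<open>G\<close> of the empirical covariance at \<open>- lam\<close>, applied to a vector.\<close>
definition ridge_solve :: "real \<Rightarrow> real^'d^'n \<Rightarrow> real^'d \<Rightarrow> real^'d" where
  "ridge_solve lam X w =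
     matrix_inv ((1 / real CARD('n)) *\<^sub>R (transpose X ** X) + lam *\<^sub>R mat 1) *v w"

lemma ridge_matrix_mult_vec:
  fixes X :: "real^'d^'n"
  shows "((1 / real CARD('n)) *\<^sub>R (transpose X ** X) + lam *\<^sub>R mat 1) *v u
    = (1 / real CARD('n)) *\<^sub>R (transpose X *v (X *v u)) + lam *\<^sub>R u"
  by (simp add: matrix_vector_mult_add_rdistrib scaleR_matrix_vector_assoc[symmetric]
      matrix_vector_mul_assoc del: transpose_matrix_vector)

lemma inner_ridge_matrix:
  fixes X :: "real^'d^'n"
  shows "u \<bullet> ((1 / real CARD('n)) *\<^sub>R (transpose X *v e) + lam *\<^sub>R u)
    = (X *v u) \<bullet> e / real CARD('n) + lam * (norm u)\<^sup>2"
proof -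
  have "u \<bullet> (transpose X *v e) = (X *v u) \<bullet> e"
    by (metis dot_lmul_matrix inner_commute transpose_matrix_vector)
  then show ?thesis by (simp add: inner_add_right power2_norm_eq_inner del: transpose_matrix_vector)
qed

text \<open>The quadratic form of the matrix is at least \<open>lam\<close> times the squared norm, so its kernel is trivial.\<close>
lemma invertible_ridge_matrix:
  fixes X :: "real^'d^'n"
  assumes "0 < lam"
  shows "invertible ((1 / real CARD('n)) *\<^sub>R (transpose X ** X) + lam *\<^sub>R mat 1)" (is "invertible ?A")
proof -
  have "u = 0" if "?A *v u = 0" for u
  proof -
    have "(X *v u) \<bullet> (X *v u) / real CARD('n) + lam * (norm u)\<^sup>2 = u \<bullet> (?A *v u)"
      by (simp only: ridge_matrix_mult_vec inner_ridge_matrix)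
    moreover have "0 \<le> (X *v u) \<bullet> (X *v u) / real CARD('n)" by simp
    ultimately have "lam * (norm u)\<^sup>2 \<le> 0" using that by (simp only: inner_zero_right)
    then show ?thesis using assms by (simp add: mult_le_0_iff)
  qed
  then show ?thesis
    by (auto simp: invertible_left_inverse matrix_left_invertible_ker)
qed

lemma matrix_inv_inverse:
  fixes A :: "real^'d^'d"
  assumes "invertible A"
  shows "A ** matrix_inv A = mat 1" "matrix_inv A ** A = mat 1"
  using assms unfolding matrix_inv_def invertible_def by (metis (mono_tags, lifting) someI_ex)+

text \<open>The properties of \<open>G\<close> below are all read off from the linear system that it solves; the inverse matrix
  itself is looked at again only for continuity.\<close>
lemma ridge_solve_iff:
  fixes X :: "real^'d^'n"
  assumes "0 < lam"
  shows "(1 / real CARD('n)) *\<^sub>R (transpose X *v (X *v u)) + lam *\<^sub>R u = w \<longleftrightarrow> u = ridge_solve lam X w"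
  unfolding ridge_matrix_mult_vec[symmetric] ridge_solve_def
  using matrix_inv_inverse[OF invertible_ridge_matrix[OF assms, of X]]
  by (auto simp: matrix_vector_mul_assoc)

lemmas ridge_solve_eq = ridge_solve_iff[THEN iffD2, OF _ refl]

lemma linear_ridge_solve: "linear (ridge_solve lam X)"
  unfolding ridge_solve_def by (rule matrix_vector_mul_linear)

lemma norm_ridge_solve_le:
  assumes "0 < lam"
  shows "norm (ridge_solve lam X w) \<le> norm w / lam"
proof -
  let ?u = "ridge_solve lam X w"
  have "lam * (norm ?u)\<^sup>2 \<le> ?u \<bullet> w"
    using inner_ridge_matrix[of ?u X "X *v ?u" lam] by (simp only: ridge_solve_eq[OF assms]) simp
  also have "\<dots> \<le> norm ?u * norm w" by (rule norm_cauchy_schwarz)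
  finally have "norm ?u * (lam * norm ?u) \<le> norm ?u * norm w"
    by (simp add: power2_eq_square mult_ac)
  then have "lam * norm ?u \<le> norm w"
    by (cases "norm ?u = 0") (simp_all add: mult_le_cancel_left)
  then show ?thesis using assms by (simp add: field_simps)
qed

text \<open>How the noise vector enters the ridge estimator.\<close>
definition noise_map :: "real \<Rightarrow> real^'d^'n \<Rightarrow> real^'n \<Rightarrow> real^'d" where
  "noise_map lam X e = ridge_solve lam X ((1 / real CARD('n)) *\<^sub>R (transpose X *v e))"

lemma linear_noise_map: "linear (noise_map lam X)"
  unfolding noise_map_def
  by (intro linear_compose[OF _ linear_ridge_solve, unfolded comp_def] linear_compose_scale_right
      matrix_vector_mul_linear)

text \<open>Writing \<open>u\<close> for the image of \<open>e\<close>, pairing the linear system for \<open>u\<close> with \<open>u\<close> gives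
  \<open>lam * \<parallel>u\<parallel>\<^sup>2 = (X u \<bullet> e - X u \<bullet> X u) / n\<close>. The negative square absorbs the design, so the bound is uniform
  in \<open>X\<close> although \<open>X\<close> occurs in the definition as an unbounded factor.\<close>
lemma norm_noise_map_le:
  fixes X :: "real^'d^'n"
  assumes "0 < lam"
  shows "lam * (norm (noise_map lam X e))\<^sup>2 \<le> (norm e)\<^sup>2"
proof -
  let ?u = "noise_map lam X e" and ?N = "real CARD('n)"
  let ?a = "X *v ?u"
  have N: "1 \<le> ?N" by (simp add: Suc_leI)
  have "(1 / ?N) *\<^sub>R (transpose X *v ?a) + lam *\<^sub>R ?u = (1 / ?N) *\<^sub>R (transpose X *v e)"
    by (simp only: noise_map_def ridge_solve_eq[OF assms])
  then have "(1 / ?N) *\<^sub>R (transpose X *v ?a) + lam *\<^sub>R ?u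
      = (1 / ?N) *\<^sub>R (transpose X *v e) + 0 *\<^sub>R ?u" by simp
  then have "?a \<bullet> ?a / ?N + lam * (norm ?u)\<^sup>2 = ?a \<bullet> e / ?N"
    using inner_ridge_matrix[of ?u X ?a lam] inner_ridge_matrix[of ?u X e 0] by simp
  then have "lam * (norm ?u)\<^sup>2 = (?a \<bullet> e - ?a \<bullet> ?a) / ?N"
    by (simp add: diff_divide_distrib)
  also have "?a \<bullet> e - ?a \<bullet> ?a \<le> (norm e)\<^sup>2"
  proof -
    have "0 \<le> (norm (?a - e))\<^sup>2 + ?a \<bullet> ?a + e \<bullet> e" by simp
    then show ?thesis by (simp add: power2_norm_eq_inner inner_diff_left inner_diff_right inner_commute)
  qed
  also have "(norm e)\<^sup>2 / ?N \<le> (norm e)\<^sup>2 / 1"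
    using N by (intro divide_left_mono) auto
  finally show ?thesis by (simp add: divide_right_mono)
qed

lemma continuous_on_det:
  fixes A :: "'a::topological_space \<Rightarrow> real^'d^'d"
  assumes "continuous_on T A"
  shows "continuous_on T (\<lambda>p. det (A p))"
  unfolding det_def by (intro continuous_intros assms)

text \<open>By Cramer's rule the entries are quotients of determinants.\<close>
lemma continuous_on_matrix_inv_mult:
  fixes A :: "'a::topological_space \<Rightarrow> real^'d^'d"
  assumes A: "continuous_on T A" and w: "continuous_on T w" and inv: "\<And>p. invertible (A p)"
  shows "continuous_on T (\<lambda>p. matrix_inv (A p) *v w p)"
proof -
  have "matrix_inv (A p) *v w p = (\<chi> k. det (\<chi> i j. if j = k then w p $ i else A p $ i $ j) / det (A p))" for p
    using cramer[of "A p" "matrix_inv (A p) *v w p" "w p"] inv[of p]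
    by (simp add: invertible_det_nz[symmetric] matrix_vector_mul_assoc matrix_inv_inverse)
  moreover have "continuous_on T (\<lambda>p. if j = k then w p $ i else A p $ i $ j)" for i j k
    by (cases "j = k") (simp_all add: continuous_on_component A w)
  ultimately show ?thesis
    using inv by (simp add: invertible_det_nz)
      (intro continuous_intros continuous_on_det A; simp)
qed

lemma continuous_on_ridge_solve:
  fixes X :: "'a::topological_space \<Rightarrow> real^'d^'n"
  assumes "0 < lam" and X: "continuous_on T X" and w: "continuous_on T w"
  shows "continuous_on T (\<lambda>p. ridge_solve lam (X p) (w p))"
  unfolding ridge_solve_def
proof (rule continuous_on_matrix_inv_mult[OF _ w invertible_ridge_matrix[OF assms(1)]])
  show "continuous_on T (\<lambda>p. (1 / real CARD('n)) *\<^sub>R (transpose (X p) ** X p) + lam *\<^sub>R mat 1)"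
    unfolding matrix_matrix_mult_def transpose_def
    by (intro continuous_intros X) simp_all
qed

lemma continuous_on_noise_map:
  fixes X :: "'a::topological_space \<Rightarrow> real^'d^'n"
  assumes "0 < lam" and X: "continuous_on T X" and e: "continuous_on T e"
  shows "continuous_on T (\<lambda>p. noise_map lam (X p) (e p))"
  unfolding noise_map_def matrix_vector_mult_def transpose_def
  by (intro continuous_on_ridge_solve continuous_intros assms) simp_all

text \<open>Applying \<open>T\<close> to every row conjugates the empirical covariance by \<open>T\<close>, hence also its resolvent.\<close>
lemma ridge_solve_orthogonal:
  fixes X :: "real^'d^'n" and T :: "real^'d \<Rightarrow> real^'d"
  assumes "0 < lam" and T: "orthogonal_transformation T"
  shows "ridge_solve lam (\<chi> i. T (X $ i)) (T w) = T (ridge_solve lam X w)"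
proof -
  let ?u = "ridge_solve lam X w"
  let ?X' = "\<chi> i. T (X $ i)"
  have lin: "linear T" using T by (rule orthogonal_transformation_linear)
  have mv: "(\<chi> i. f i) *v z = (\<chi> i. f i \<bullet> z)" for f :: "'n \<Rightarrow> real^'d" and z
    by (simp add: vec_eq_iff matrix_vector_mult_def inner_vec_def)
  have tmv: "transpose Y *v e = (\<Sum>i\<in>UNIV. e $ i *\<^sub>R (Y $ i))" for Y :: "real^'d^'n" and e
    by (simp add: vec_eq_iff matrix_vector_mult_def transpose_def mult.commute
        del: transpose_matrix_vector)
  have "?X' *v T ?u = (\<chi> i. X $ i) *v ?u"
    using T by (simp only: mv orthogonal_transformation_def)
  then have "?X' *v T ?u = X *v ?u" by simp
  then have "(1 / real CARD('n)) *\<^sub>R (transpose ?X' *v (?X' *v T ?u)) + lam *\<^sub>R T ?u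
      = T ((1 / real CARD('n)) *\<^sub>R (transpose X *v (X *v ?u)) + lam *\<^sub>R ?u)"
    by (simp add: tmv linear_add[OF lin] linear_scale[OF lin] linear_sum[OF lin]
        del: transpose_matrix_vector)
  also have "\<dots> = T w" by (simp only: ridge_solve_eq[OF assms(1)])
  finally show ?thesis using ridge_solve_iff[OF assms(1)] by metis
qed

text \<open>Since the empirical covariance is the ridge matrix minus \<open>lam\<close>, applying \<open>G\<close> to its product with
  \<open>b\<close> returns \<open>b\<close> minus the shrinkage \<open>lam * G b\<close>.\<close>
lemma ridge_estimator_error:
  fixes X :: "real^'d^'n"
  assumes "0 < lam"
  shows "ridge_estimator lam X (X *v b + s *\<^sub>R e) - b
    = s *\<^sub>R noise_map lam X e - lam *\<^sub>R ridge_solve lam X b"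
proof -
  let ?c = "1 / real CARD('n)"
  have "ridge_solve lam X (?c *\<^sub>R (transpose X *v (X *v b)) + lam *\<^sub>R b) = b"
    using ridge_solve_iff[OF assms] by metis
  then have fit: "ridge_solve lam X (?c *\<^sub>R (transpose X *v (X *v b))) + lam *\<^sub>R ridge_solve lam X b = b"
    by (simp only: linear_add[OF linear_ridge_solve] linear_scale[OF linear_ridge_solve])
  have "ridge_estimator lam X (X *v b + s *\<^sub>R e)
      = ridge_solve lam X (?c *\<^sub>R (transpose X *v (X *v b)) + s *\<^sub>R (?c *\<^sub>R (transpose X *v e)))"
    by (simp add: ridge_estimator_def ridge_solve_def matrix_vector_right_distrib
        matrix_vector_mult_scaleR scaleR_add_right mult.commute del: transpose_matrix_vector)
  also have "\<dots> = ridge_solve lam X (?c *\<^sub>R (transpose X *v (X *v b))) + s *\<^sub>R noise_map lam X e"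
    by (simp only: linear_add[OF linear_ridge_solve] linear_scale[OF linear_ridge_solve] noise_map_def)
  finally show ?thesis using fit by (simp add: algebra_simps)
qed

section \<open>Independent samples with centred noise\<close>

lemma borel_measurable_vec_lambda:
  fixes f :: "'n::finite \<Rightarrow> 'a \<Rightarrow> 'b::euclidean_space"
  assumes [measurable]: "\<And>i. f i \<in> borel_measurable M"
  shows "(\<lambda>p. \<chi> i. f i p) \<in> borel_measurable M"
proof (subst borel_measurable_euclidean_space, intro ballI)
  fix b :: "'b^'n" assume "b \<in> Basis"
  show "(\<lambda>p. (\<chi> i. f i p) \<bullet> b) \<in> borel_measurable M"
    by (simp add: inner_vec_def)
qed

text \<open>Independence makes the law of the design the product of its marginals.\<close>
lemma integral_design_cong_marginals:
  fixes x y :: "'n::finite \<Rightarrow> 'w \<Rightarrow> real^'d" and h :: "real^'d^'n \<Rightarrow> real"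
  assumes "prob_space M"
    and ix: "prob_space.indep_vars M (\<lambda>_. borel) x UNIV"
    and iy: "prob_space.indep_vars M (\<lambda>_. borel) y UNIV"
    and eq: "\<And>i. distr M borel (x i) = distr M borel (y i)"
    and [measurable]: "h \<in> borel_measurable borel"
  shows "(\<integral>\<omega>. h (design x \<omega>) \<partial>M) = (\<integral>\<omega>. h (design y \<omega>) \<partial>M)"
proof -
  interpret prob_space M by fact
  let ?\<Pi> = "\<Pi>\<^sub>M i\<in>(UNIV :: 'n set). (borel :: (real^'d) measure)"
  have law: "(\<integral>\<omega>. h (design z \<omega>) \<partial>M)
      = (\<integral>p. h (\<chi> i. p i) \<partial>(\<Pi>\<^sub>M i\<in>UNIV. distr M borel (z i)))"
    if iz: "indep_vars (\<lambda>_. borel) z UNIV" for z :: "'n \<Rightarrow> 'w \<Rightarrow> real^'d"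
  proof -
    have [measurable]: "z i \<in> borel_measurable M" for i
      using iz by (auto simp: indep_vars_def)
    have [measurable]: "(\<lambda>p. \<chi> i. p i) \<in> borel_measurable ?\<Pi>"
      by (rule borel_measurable_vec_lambda) measurable
    have "(\<Pi>\<^sub>M i\<in>UNIV. distr M borel (z i)) = distr M ?\<Pi> (\<lambda>\<omega>. \<lambda>i\<in>UNIV. z i \<omega>)"
      by (rule indep_vars_iff_distr_eq_PiM[THEN iffD1, OF _ _ iz, symmetric]) auto
    then show ?thesis
      by (simp only:) (subst integral_distr; simp add: design_def; simp add: restrict_UNIV)
  qed
  show ?thesis by (simp add: law[OF ix] law[OF iy] eq)
qed

text \<open>Boundedness of \<open>h\<close> makes the product integrable, so that the factor \<open>h (X \<omega>)\<close>, which is measurable for the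
  conditioning sigma-algebra, can be moved across the conditional expectation.\<close>
lemma integral_noise_times_bounded:
  fixes X :: "'w \<Rightarrow> 'a::euclidean_space" and h :: "'a \<Rightarrow> real"
  assumes "prob_space M"
    and [measurable]: "X \<in> borel_measurable M"
    and int: "integrable M e"
    and cond: "AE \<omega> in M. real_cond_exp M (vimage_algebra (space M) X borel) e \<omega> = 0"
    and [measurable]: "h \<in> borel_measurable borel"
    and bnd: "\<And>a. \<bar>h a\<bar> \<le> K"
  shows "(\<integral>\<omega>. e \<omega> * h (X \<omega>) \<partial>M) = 0"
proof -
  interpret prob_space M by fact
  let ?F = "vimage_algebra (space M) X borel"
  have sub: "subalgebra M ?F"
    unfolding subalgebra_def by (auto simp: sets_vimage_algebra2)
  interpret finite_measure_subalgebra M ?F by unfold_locales (rule sub)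
  have [measurable]: "X \<in> measurable ?F borel"
    by (rule measurable_vimage_algebra1) simp
  have i: "integrable M (\<lambda>\<omega>. h (X \<omega>) * e \<omega>)"
    by (rule Bochner_Integration.integrable_bound[OF integrable_mult_right[OF int, of K]])
      (use int bnd in \<open>auto simp: abs_mult intro!: mult_right_mono order_trans[OF bnd abs_ge_self]\<close>)
  have "(\<integral>\<omega>. e \<omega> * h (X \<omega>) \<partial>M) = (\<integral>\<omega>. h (X \<omega>) * real_cond_exp M ?F e \<omega> \<partial>M)"
    using int by (subst real_cond_exp_intg(2)[OF i]) (auto simp: mult.commute)
  also have "\<dots> = (\<integral>\<omega>. 0 \<partial>M)"
    by (rule integral_cong_AE) (use cond in auto)
  finally show ?thesis by simp
qed

text \<open>The hypothesis conditions \<open>\<epsilon> i\<close> on \<open>x i\<close> alone, while \<open>g\<close> sees all covariates. Independence of the samples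
  bridges this: under the product law, with every sample except the \<open>i\<close>-th frozen, \<open>g\<close> becomes
  a bounded function of \<open>x i\<close>, and the inner integral vanishes.\<close>
lemma integral_noise_times_design:
  fixes x :: "'n::finite \<Rightarrow> 'w \<Rightarrow> real^'d" and g :: "real^'d^'n \<Rightarrow> real"
  assumes "prob_space M"
    and indep: "prob_space.indep_vars M (\<lambda>_. borel) (\<lambda>i \<omega>. (x i \<omega>, \<epsilon> i \<omega>)) UNIV"
    and int: "integrable M (\<epsilon> i)"
    and cond: "AE \<omega> in M. real_cond_exp M (vimage_algebra (space M) (x i) borel) (\<epsilon> i) \<omega> = 0"
    and [measurable]: "g \<in> borel_measurable borel"
    and bnd: "\<And>X. \<bar>g X\<bar> \<le> K"
  shows "integrable M (\<lambda>\<omega>. \<epsilon> i \<omega> * g (design x \<omega>))"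
    and "(\<integral>\<omega>. \<epsilon> i \<omega> * g (design x \<omega>) \<partial>M) = 0"
proof -
  interpret prob_space M by fact
  define z where "z k \<omega> = (x k \<omega>, \<epsilon> k \<omega>)" for k \<omega>
  have [measurable]: "z k \<in> borel_measurable M" for k
    using indep by (auto simp: indep_vars_def z_def[abs_def])
  let ?B = "borel :: ((real^'d) \<times> real) measure"
  have [measurable]: "fst \<in> borel_measurable ?B" "snd \<in> borel_measurable ?B"
    by (intro borel_measurable_continuous_onI continuous_intros)+
  have "(\<lambda>\<omega>. fst (z k \<omega>)) \<in> borel_measurable M" "(\<lambda>\<omega>. snd (z k \<omega>)) \<in> borel_measurable M" for k
    by measurable
  then have [measurable]: "x k \<in> borel_measurable M" "\<epsilon> k \<in> borel_measurable M" for k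
    by (simp_all add: z_def)
  have [measurable]: "design x \<in> borel_measurable M"
    unfolding design_def[abs_def] by (rule borel_measurable_vec_lambda) simp
  show i: "integrable M (\<lambda>\<omega>. \<epsilon> i \<omega> * g (design x \<omega>))"
    by (rule Bochner_Integration.integrable_bound[OF integrable_mult_left[OF int, of K]])
      (use bnd in \<open>auto simp: abs_mult intro!: mult_left_mono order_trans[OF bnd abs_ge_self]\<close>)
  let ?Q = "\<lambda>k. distr M ?B (z k)"
  interpret Q: prob_space "?Q k" for k by (rule prob_space_distr) simp
  interpret Q: product_sigma_finite ?Q ..
  let ?f = "\<lambda>p. snd (p i) * g (\<chi> k. fst (p k))"
  have [measurable]: "(\<lambda>p. \<chi> k. fst (p k)) \<in> borel_measurable (\<Pi>\<^sub>M k\<in>UNIV. ?B)"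
    by (rule borel_measurable_vec_lambda) measurable
  have [measurable]: "?f \<in> borel_measurable (\<Pi>\<^sub>M k\<in>UNIV. ?B)" by measurable
  have law: "(\<Pi>\<^sub>M k\<in>UNIV. ?Q k) = distr M (\<Pi>\<^sub>M k\<in>UNIV. ?B) (\<lambda>\<omega>. \<lambda>k\<in>UNIV. z k \<omega>)"
    by (rule indep_vars_iff_distr_eq_PiM[THEN iffD1, symmetric])
      (use indep in \<open>auto simp: z_def[abs_def]\<close>)
  have ins: "insert i (UNIV - {i}) = UNIV" by auto
  have int_f: "integrable (\<Pi>\<^sub>M k\<in>insert i (UNIV - {i}). ?Q k) ?f"
    using i unfolding ins law by (subst integrable_distr_eq) (auto simp: z_def design_def)
  have "(\<integral>\<omega>. \<epsilon> i \<omega> * g (design x \<omega>) \<partial>M) = (\<integral>p. ?f p \<partial>(\<Pi>\<^sub>M k\<in>insert i (UNIV - {i}). ?Q k))"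
    unfolding ins law by (subst integral_distr) (auto simp: z_def design_def)
  also have "\<dots> = (\<integral>p. (\<integral>y. ?f (p(i := y)) \<partial>?Q i) \<partial>(\<Pi>\<^sub>M k\<in>UNIV - {i}. ?Q k))"
    by (rule Q.product_integral_insert[OF _ _ int_f]) auto
  also have "\<dots> = (\<integral>p. 0 \<partial>(\<Pi>\<^sub>M k\<in>UNIV - {i}. ?Q k))"
  proof (rule Bochner_Integration.integral_cong[OF refl])
    fix p :: "'n \<Rightarrow> (real^'d) \<times> real"
    define h where "h a = g (\<chi> k. if k = i then a else fst (p k))" for a
    have [measurable]: "(\<lambda>a. \<chi> k. if k = i then a else fst (p k)) \<in> borel_measurable borel"
      by (rule borel_measurable_vec_lambda) simp
    have [measurable]: "h \<in> borel_measurable borel" unfolding h_def[abs_def] by measurable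
    have "(\<integral>y. ?f (p(i := y)) \<partial>?Q i) = (\<integral>y. snd y * h (fst y) \<partial>?Q i)"
      by (simp add: h_def if_distrib cong: if_cong)
    also have "\<dots> = (\<integral>\<omega>. \<epsilon> i \<omega> * h (x i \<omega>) \<partial>M)"
      by (subst integral_distr) (auto simp: z_def)
    also have "\<dots> = 0"
      by (rule integral_noise_times_bounded[where K = K]) (use assms(1) int cond bnd in \<open>auto simp: h_def\<close>)
    finally show "(\<integral>y. ?f (p(i := y)) \<partial>?Q i) = 0" .
  qed
  finally show "(\<integral>\<omega>. \<epsilon> i \<omega> * g (design x \<omega>) \<partial>M) = 0" by simp
qed

section \<open>Symmetry of the bias\<close>

text \<open>The squared bias at \<open>b\<close> is \<open>lam\<^sup>2\<close> times the diagonal value at \<open>b\<close>, with \<open>R\<close> the square root of the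
  covariance. The polar form is kept because its vanishing off the diagonal is what the reflections give.\<close>
definition bias_form :: "'w measure \<Rightarrow> ('n::finite \<Rightarrow> 'w \<Rightarrow> real^'d) \<Rightarrow> real^'d^'d \<Rightarrow> real \<Rightarrow> real^'d \<Rightarrow> real^'d \<Rightarrow> real" where
  "bias_form M x R lam a b =
     (\<integral>\<omega>. (R *v ridge_solve lam (design x \<omega>) a) \<bullet> (R *v ridge_solve lam (design x \<omega>) b) \<partial>M)"

text \<open>The constants do not depend on the design. This gives integrability without any moment of the design, and
  boundedness of the coefficients of the noise in the cross term.\<close>
lemma bounded_inner_residuals:
  fixes R :: "real^'d^'d"
  assumes "0 < lam"
  obtains K where "\<And>X :: real^'d^'n. \<And>a b. \<bar>(R *v ridge_solve lam X a) \<bullet> (R *v ridge_solve lam X b)\<bar>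
                       \<le> K * norm a * norm b"
    and "\<And>X :: real^'d^'n. \<And>a e. \<bar>(R *v ridge_solve lam X a) \<bullet> (R *v noise_map lam X e)\<bar>
                       \<le> K * norm a * norm e"
    and "\<And>X :: real^'d^'n. \<And>e. (norm (R *v noise_map lam X e))\<^sup>2 \<le> K * (norm e)\<^sup>2"
proof -
  obtain L where L: "0 < L" "\<And>u. norm (R *v u) \<le> norm u * L"
    using bounded_linear.pos_bounded[OF matrix_vector_mul_bounded_linear[of R]] by blast
  \<comment> \<open>a common operator norm bound for \<^const>\<open>ridge_solve\<close> and \<^const>\<open>noise_map\<close>\<close>
  define c where "c = max (1 / lam) (1 / sqrt lam)"
  have s: "norm (ridge_solve lam X a) \<le> c * norm a" for X :: "real^'d^'n" and a
  proof -
    have "norm (ridge_solve lam X a) \<le> 1 / lam * norm a"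
      using norm_ridge_solve_le[OF assms, of X a] by simp
    also have "\<dots> \<le> c * norm a" by (rule mult_right_mono) (simp_all add: c_def)
    finally show ?thesis .
  qed
  have n: "norm (noise_map lam X e) \<le> c * norm e" for X :: "real^'d^'n" and e
  proof -
    have "(norm (noise_map lam X e))\<^sup>2 \<le> (norm e)\<^sup>2 / lam"
      using norm_noise_map_le[OF assms, of X e] assms by (simp add: field_simps)
    also have "\<dots> = (1 / sqrt lam * norm e)\<^sup>2"
      using assms by (simp add: power_divide)
    finally have "norm (noise_map lam X e) \<le> 1 / sqrt lam * norm e"
      by (rule power2_le_imp_le) (use assms in simp)
    also have "\<dots> \<le> c * norm e" by (rule mult_right_mono) (simp_all add: c_def)
    finally show ?thesis .
  qed
  have R: "norm (R *v u) \<le> L * c * r" if "norm u \<le> c * r" for u r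
    using order_trans[OF L(2)[of u] mult_right_mono[OF that, of L]] L(1) by (simp add: mult_ac)
  have ip: "\<bar>u \<bullet> w\<bar> \<le> (L * c)\<^sup>2 * r * q" if "norm u \<le> L * c * r" "norm w \<le> L * c * q" for u w :: "real^'d" and r q
  proof -
    have "\<bar>u \<bullet> w\<bar> \<le> norm u * norm w" by (rule Cauchy_Schwarz_ineq2)
    also have "\<dots> \<le> (L * c * r) * (L * c * q)"
      using that by (intro mult_mono) (auto intro: order_trans[OF norm_ge_zero])
    finally show ?thesis by (simp add: power2_eq_square mult_ac)
  qed
  show thesis
  proof (rule that[of "(L * c)\<^sup>2"])
    show "\<bar>(R *v ridge_solve lam X a) \<bullet> (R *v ridge_solve lam X b)\<bar> \<le> (L * c)\<^sup>2 * norm a * norm b"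
      for X :: "real^'d^'n" and a b by (intro ip R s)
    show "\<bar>(R *v ridge_solve lam X a) \<bullet> (R *v noise_map lam X e)\<bar> \<le> (L * c)\<^sup>2 * norm a * norm e"
      for X :: "real^'d^'n" and a e by (intro ip R s n)
    show "(norm (R *v noise_map lam X e))\<^sup>2 \<le> (L * c)\<^sup>2 * (norm e)\<^sup>2"
      for X :: "real^'d^'n" and e
      using power_mono[OF R[OF n[of X e]], of 2] by (simp add: power_mult_distrib)
  qed
qed

lemma borel_measurable_residuals:
  fixes R :: "real^'d^'d" and X :: "'w \<Rightarrow> real^'d^'n" and e :: "'w \<Rightarrow> real^'n"
  assumes "0 < lam" and X: "X \<in> borel_measurable M" and e: "e \<in> borel_measurable M"
  shows "(\<lambda>\<omega>. R *v ridge_solve lam (X \<omega>) a) \<in> borel_measurable M"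
    and "(\<lambda>\<omega>. R *v noise_map lam (X \<omega>) (e \<omega>)) \<in> borel_measurable M"
proof -
  show "(\<lambda>\<omega>. R *v ridge_solve lam (X \<omega>) a) \<in> borel_measurable M"
    by (rule borel_measurable_continuous_on[OF _ X])
      (intro linear_continuous_on_compose[OF _ matrix_vector_mul_linear]
        continuous_on_ridge_solve assms(1) continuous_intros)
  have "(\<lambda>\<omega>. (\<lambda>p. R *v noise_map lam (fst p) (snd p)) (X \<omega>, e \<omega>)) \<in> borel_measurable M"
    by (rule borel_measurable_continuous_on[OF _ borel_measurable_Pair[OF X e]])
      (intro linear_continuous_on_compose[OF _ matrix_vector_mul_linear]
        continuous_on_noise_map assms(1) continuous_intros)
  then show "(\<lambda>\<omega>. R *v noise_map lam (X \<omega>) (e \<omega>)) \<in> borel_measurable M" by simp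
qed

lemma borel_measurable_design:
  assumes "\<And>i. x i \<in> borel_measurable M"
  shows "design x \<in> borel_measurable M"
  unfolding design_def[abs_def] by (rule borel_measurable_vec_lambda) (rule assms)

lemma integrable_bias_form:
  fixes x :: "'n::finite \<Rightarrow> 'w \<Rightarrow> real^'d" and R :: "real^'d^'d"
  assumes "prob_space M" and "0 < lam" and x: "\<And>i. x i \<in> borel_measurable M"
  shows "integrable M (\<lambda>\<omega>. (R *v ridge_solve lam (design x \<omega>) a) \<bullet> (R *v ridge_solve lam (design x \<omega>) b))"
proof -
  interpret prob_space M by fact
  obtain K where K: "\<And>X :: real^'d^'n. \<bar>(R *v ridge_solve lam X a) \<bullet> (R *v ridge_solve lam X b)\<bar> \<le> K * norm a * norm b"
    using bounded_inner_residuals[OF assms(2), of R] by metis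
  note [measurable] = borel_measurable_residuals(1)[OF assms(2) borel_measurable_design[OF x] borel_measurable_const]
  show ?thesis
    by (rule integrable_const_bound[where B = "K * norm a * norm b"]) (use K in auto)
qed

lemma bias_form_sum_scaleR:
  fixes x :: "'n::finite \<Rightarrow> 'w \<Rightarrow> real^'d" and R :: "real^'d^'d"
  assumes "prob_space M" and "0 < lam" and "\<And>i. x i \<in> borel_measurable M" and "finite J"
  shows "bias_form M x R lam (\<Sum>j\<in>J. c j *\<^sub>R v j) (\<Sum>j\<in>J. c j *\<^sub>R v j)
    = (\<Sum>j\<in>J. \<Sum>k\<in>J. c j * c k * bias_form M x R lam (v j) (v k))"
proof -
  note int = integrable_bias_form[OF assms(1-3)]
  have lin: "linear (\<lambda>a. R *v ridge_solve lam X a)" for X :: "real^'d^'n"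
    by (intro linear_compose[OF linear_ridge_solve matrix_vector_mul_linear, unfolded comp_def])
  show ?thesis
    unfolding bias_form_def linear_sum[OF lin] linear_scale[OF lin] inner_sum_left
    by (simp add: inner_sum_right int sum_distrib_left mult_ac)
qed

text \<open>Replacing every covariate \<open>x i\<close> by \<open>T (x i)\<close> leaves the law of the design unchanged, and on the residuals it
  amounts to conjugating the resolvent by \<open>T\<close>.\<close>
lemma bias_form_orthogonal:
  fixes x :: "'n::finite \<Rightarrow> 'w \<Rightarrow> real^'d"
  assumes M: "prob_space M" and "0 < lam"
    and indep: "prob_space.indep_vars M (\<lambda>_. borel) x UNIV"
    and law: "\<And>i. distr M borel (x i) = gaussian S"
    and T: "orthogonal_transformation T"
    and comm: "\<And>z. T (mat_sqrt S *v z) = mat_sqrt S *v T z"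
  shows "bias_form M x (mat_sqrt S) lam (T a) (T b) = bias_form M x (mat_sqrt S) lam a b"
proof -
  interpret prob_space M by fact
  have x [measurable]: "x i \<in> borel_measurable M" for i
    using indep by (auto simp: indep_vars_def)
  have T_m [measurable]: "T \<in> borel_measurable borel"
    using T by (simp add: orthogonal_transformation_linear
        borel_measurable_continuous_onI linear_continuous_on linear_conv_bounded_linear[symmetric])
  let ?R = "mat_sqrt S"
  let ?h = "\<lambda>X::real^'d^'n. (?R *v ridge_solve lam X (T a)) \<bullet> (?R *v ridge_solve lam X (T b))"
  have [measurable]: "?h \<in> borel_measurable borel"
    by (intro borel_measurable_inner borel_measurable_residuals(1)[OF assms(2), where e = "\<lambda>_. 0"]) simp_all
  have "bias_form M x ?R lam (T a) (T b) = (\<integral>\<omega>. ?h (design x \<omega>) \<partial>M)"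
    by (simp add: bias_form_def)
  also have "\<dots> = (\<integral>\<omega>. ?h (design (\<lambda>i \<omega>. T (x i \<omega>)) \<omega>) \<partial>M)"
  proof (rule integral_design_cong_marginals[OF M indep])
    show "indep_vars (\<lambda>_. borel) (\<lambda>i \<omega>. T (x i \<omega>)) UNIV"
      by (rule indep_vars_compose2[OF indep]) simp
    show "distr M borel (x i) = distr M borel (\<lambda>\<omega>. T (x i \<omega>))" for i
    proof -
      have "distr M borel (\<lambda>\<omega>. T (x i \<omega>)) = distr (distr M borel (x i)) borel T"
        by (subst distr_distr) (simp_all add: comp_def)
      then show ?thesis by (simp add: law distr_gaussian_orthogonal[OF T comm])
    qed
  qed simp
  also have "\<dots> = bias_form M x ?R lam a b"
    unfolding bias_form_def
  proof (rule Bochner_Integration.integral_cong[OF refl])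
    fix \<omega>
    have "design (\<lambda>i \<omega>. T (x i \<omega>)) \<omega> = (\<chi> i. T (design x \<omega> $ i))" by (simp add: design_def)
    then show "?h (design (\<lambda>i \<omega>. T (x i \<omega>)) \<omega>)
        = (?R *v ridge_solve lam (design x \<omega>) a) \<bullet> (?R *v ridge_solve lam (design x \<omega>) b)"
      using T by (simp add: ridge_solve_orthogonal[OF assms(2) T] comm[symmetric] orthogonal_transformation_def)
  qed
  finally show ?thesis .
qed

text \<open>Two families of symmetries commuting with \<open>S\<close> suffice. The reflection along \<open>v j\<close> changes the sign of \<open>v j\<close>
  and fixes \<open>v k\<close>, so the form is diagonal. If \<open>v j\<close> and \<open>v k\<close> share an eigenvalue, their difference is again an
  eigenvector, and the reflection along it swaps them, so the diagonal depends on the eigenvalue only.\<close>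
lemma bias_form_eigenvectors:
  fixes x :: "'n::finite \<Rightarrow> 'w \<Rightarrow> real^'d" and S :: "real^'d^'d"
  assumes M: "prob_space M" and "0 < lam"
    and indep: "prob_space.indep_vars M (\<lambda>_. borel) x UNIV"
    and law: "\<And>i. distr M borel (x i) = gaussian S"
    and psd: "pos_semidef S" and orth: "orthonormal_family v" and eig: "\<And>j. S *v v j = \<tau> j *\<^sub>R v j"
  shows "j \<noteq> k \<Longrightarrow> bias_form M x (mat_sqrt S) lam (v j) (v k) = 0"
    and "\<tau> j = \<tau> k \<Longrightarrow> bias_form M x (mat_sqrt S) lam (v j) (v j) = bias_form M x (mat_sqrt S) lam (v k) (v k)"
proof -
  let ?R = "mat_sqrt S"
  note sq = mat_sqrt_eq_spectral_fun[OF psd orth eig]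
  have Rv: "?R *v v j = sqrt (\<tau> j) *\<^sub>R v j" for j
    by (simp add: sq(1) spectral_fun_eigvec[OF orth])
  have inner_v: "v j \<bullet> v k = (if j = k then 1 else 0)" for j k
    using orth by (simp add: orthonormal_family_def)
  have inv: "bias_form M x ?R lam (reflection u a) (reflection u b) = bias_form M x ?R lam a b"
    if "?R *v u = s *\<^sub>R u" for u s a b
    using sq(2) that unfolding pos_semidef_def
    by (intro bias_form_orthogonal[OF M assms(2) indep law] orthogonal_transformation_reflection
        reflection_commute) auto
  have neg: "bias_form M x ?R lam (- a) b = - bias_form M x ?R lam a b" for a b
  proof -
    have "ridge_solve lam X (- a) = - ridge_solve lam X a" for X :: "real^'d^'n"
      by (rule linear_neg[OF linear_ridge_solve])
    moreover have "?R *v (- u) = - (?R *v u)" for u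
      by (rule linear_neg[OF matrix_vector_mul_linear])
    ultimately show ?thesis by (simp add: bias_form_def)
  qed
  show "bias_form M x ?R lam (v j) (v k) = 0" if "j \<noteq> k"
  proof -
    have "reflection (v j) (v j) = - v j" "reflection (v j) (v k) = v k"
      using that by (simp_all add: reflection_def inner_v scaleR_2)
    then show ?thesis using inv[OF Rv, of j "v j" "v k"] neg by simp
  qed
  show "bias_form M x ?R lam (v j) (v j) = bias_form M x ?R lam (v k) (v k)" if "\<tau> j = \<tau> k"
  proof (cases "j = k")
    case False
    have "?R *v (v j - v k) = sqrt (\<tau> j) *\<^sub>R (v j - v k)"
      using that by (simp add: matrix_vector_mult_diff_distrib Rv scaleR_diff_right)
    moreover have "reflection (v j - v k) (v j) = v k"
      using False by (simp add: reflection_def inner_v inner_diff_left inner_diff_right)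
    ultimately show ?thesis using inv[of "v j - v k" "sqrt (\<tau> j)" "v j" "v j"] by simp
  qed simp
qed

section \<open>Bias-variance decomposition\<close>

text \<open>In the expanded square, the cross term has mean zero and the noise term does not involve \<open>b\<close>. Integrability of each
  term turns the nonnegative integral into a finite one that can be split.\<close>
lemma ridge_risk_eq:
  fixes x :: "'n::finite \<Rightarrow> 'w \<Rightarrow> real^'d" and S :: "real^'d^'d"
  assumes M: "prob_space M" and lam: "0 < lam"
    and indep: "prob_space.indep_vars M (\<lambda>_. borel) (\<lambda>i \<omega>. (x i \<omega>, \<epsilon> i \<omega>)) UNIV"
    and int: "\<And>i. integrable M (\<epsilon> i)" and int2: "\<And>i. integrable M (\<lambda>\<omega>. (\<epsilon> i \<omega>)\<^sup>2)"
    and cond: "\<And>i. AE \<omega> in M. real_cond_exp M (vimage_algebra (space M) (x i) borel) (\<epsilon> i) \<omega> = 0"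
    and x: "\<And>i. x i \<in> borel_measurable M"
  obtains c where "0 \<le> c"
    and "\<And>b. ridge_risk M x \<epsilon> S \<sigma> lam b = ennreal (lam\<^sup>2 * bias_form M x (mat_sqrt S) lam b b + c)"
proof -
  interpret prob_space M by fact
  let ?R = "mat_sqrt S"
  define e where "e \<omega> = (\<chi> i. \<epsilon> i \<omega>)" for \<omega>
  let ?g = "\<lambda>b \<omega>. ?R *v ridge_solve lam (design x \<omega>) b"
  let ?n = "\<lambda>\<omega>. ?R *v noise_map lam (design x \<omega>) (e \<omega>)"
  have eps [measurable]: "\<epsilon> i \<in> borel_measurable M" for i using int[of i] by simp
  have e_m: "e \<in> borel_measurable M"
    unfolding e_def[abs_def] by (rule borel_measurable_vec_lambda) simp
  note int_g = integrable_bias_form[where x = x, OF M lam x]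
  note design_m = borel_measurable_design[OF x]
  note [measurable] = borel_measurable_residuals[OF lam design_m e_m]
  obtain K where
    K1: "\<And>(X :: real^'d^'n) a e. \<bar>(?R *v ridge_solve lam X a) \<bullet> (?R *v noise_map lam X e)\<bar> \<le> K * norm a * norm e" and
    K2: "\<And>(X :: real^'d^'n) e. (norm (?R *v noise_map lam X e))\<^sup>2 \<le> K * (norm e)\<^sup>2"
    using bounded_inner_residuals[OF lam, of ?R] by metis
  have int_n: "integrable M (\<lambda>\<omega>. (norm (?n \<omega>))\<^sup>2)"
  proof (rule Bochner_Integration.integrable_bound)
    show "integrable M (\<lambda>\<omega>. K * (\<Sum>i\<in>UNIV. (\<epsilon> i \<omega>)\<^sup>2))"
      using int2 by (intro integrable_mult_right Bochner_Integration.integrable_sum)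
    have "(norm (?n \<omega>))\<^sup>2 \<le> K * (\<Sum>i\<in>UNIV. (\<epsilon> i \<omega>)\<^sup>2)" for \<omega>
    proof -
      have "(norm (e \<omega>))\<^sup>2 = (\<Sum>i\<in>UNIV. (\<epsilon> i \<omega>)\<^sup>2)"
        by (simp only: power2_norm_eq_inner) (simp add: inner_vec_def e_def power2_eq_square)
      then show ?thesis using K2[of "design x \<omega>" "e \<omega>"] by simp
    qed
    then show "AE \<omega> in M. norm ((norm (?n \<omega>))\<^sup>2) \<le> norm (K * (\<Sum>i\<in>UNIV. (\<epsilon> i \<omega>)\<^sup>2))"
      by (intro AE_I2) (force intro: order_trans[OF _ abs_ge_self])
  qed measurable
  have cross: "integrable M (\<lambda>\<omega>. ?g b \<omega> \<bullet> ?n \<omega>)" "(\<integral>\<omega>. ?g b \<omega> \<bullet> ?n \<omega> \<partial>M) = 0" for b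
  proof -
    let ?f = "\<lambda>i (X :: real^'d^'n). (?R *v ridge_solve lam X b) \<bullet> (?R *v noise_map lam X (axis i 1))"
    have lin: "linear (\<lambda>a. ?R *v noise_map lam X a)" for X :: "real^'d^'n"
      by (intro linear_compose[OF linear_noise_map matrix_vector_mul_linear, unfolded comp_def])
    have ax: "e \<omega> = (\<Sum>i\<in>UNIV. \<epsilon> i \<omega> *\<^sub>R axis i 1)" for \<omega>
      by (simp add: e_def vec_eq_iff axis_def if_distrib cong: if_cong)
    \<comment> \<open>the cross term is a sum of noise coordinates with coefficients that depend on the design only\<close>
    have expand: "?g b \<omega> \<bullet> ?n \<omega> = (\<Sum>i\<in>UNIV. \<epsilon> i \<omega> * ?f i (design x \<omega>))" for \<omega>
      by (simp add: ax linear_sum[OF lin] linear_scale[OF lin] inner_sum_right)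
    have "?f i \<in> borel_measurable borel" for i
      by (intro borel_measurable_inner borel_measurable_residuals[OF lam, where e = "\<lambda>_. axis i 1"]) simp_all
    moreover have "\<bar>?f i X\<bar> \<le> K * norm b" for i X
      using K1[of X b "axis i 1"] by simp
    ultimately have *: "integrable M (\<lambda>\<omega>. \<epsilon> i \<omega> * ?f i (design x \<omega>))"
      "(\<integral>\<omega>. \<epsilon> i \<omega> * ?f i (design x \<omega>) \<partial>M) = 0" for i
      by (intro integral_noise_times_design[OF M indep int cond]; blast)+
    show "integrable M (\<lambda>\<omega>. ?g b \<omega> \<bullet> ?n \<omega>)" "(\<integral>\<omega>. ?g b \<omega> \<bullet> ?n \<omega> \<partial>M) = 0"
      unfolding expand by (simp_all add: * Bochner_Integration.integral_sum)
  qed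
  define c where "c = \<sigma>\<^sup>2 * (\<integral>\<omega>. (norm (?n \<omega>))\<^sup>2 \<partial>M)"
  show thesis
  proof (rule that)
    show "0 \<le> c" by (simp add: c_def)
    fix b
    let ?F = "\<lambda>\<omega>. lam\<^sup>2 * (?g b \<omega> \<bullet> ?g b \<omega>) - 2 * lam * \<sigma> * (?g b \<omega> \<bullet> ?n \<omega>) + \<sigma>\<^sup>2 * (norm (?n \<omega>))\<^sup>2"
    have F: "(norm (?R *v (ridge_estimator lam (design x \<omega>) (response \<sigma> x \<epsilon> b \<omega>) - b)))\<^sup>2 = ?F \<omega>" for \<omega>
    proof -
      have "response \<sigma> x \<epsilon> b \<omega> = design x \<omega> *v b + \<sigma> *\<^sub>R e \<omega>"
        by (simp add: response_def design_def e_def vec_eq_iff matrix_vector_mult_def inner_vec_def mult.commute)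
      then have "?R *v (ridge_estimator lam (design x \<omega>) (response \<sigma> x \<epsilon> b \<omega>) - b)
          = \<sigma> *\<^sub>R ?n \<omega> - lam *\<^sub>R ?g b \<omega>"
        by (simp add: ridge_estimator_error[OF lam] matrix_vector_mult_diff_distrib matrix_vector_mult_scaleR)
      then show ?thesis
        by (simp add: power2_norm_eq_inner inner_diff_left inner_diff_right inner_commute)
          (simp add: algebra_simps power2_eq_square)
    qed
    have intF: "integrable M ?F"
      using int_g cross(1) int_n by simp
    have nn: "0 \<le> ?F \<omega>" for \<omega> unfolding F[symmetric] by simp
    have "ridge_risk M x \<epsilon> S \<sigma> lam b = (\<integral>\<^sup>+\<omega>. ennreal (?F \<omega>) \<partial>M)"
      by (simp only: ridge_risk_def F)
    also have "\<dots> = ennreal (\<integral>\<omega>. ?F \<omega> \<partial>M)"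
      using intF nn by (intro nn_integral_eq_integral) auto
    also have "(\<integral>\<omega>. ?F \<omega> \<partial>M) = lam\<^sup>2 * bias_form M x ?R lam b b + c"
      using int_g cross int_n by (simp add: bias_form_def c_def)
    finally show "ridge_risk M x \<epsilon> S \<sigma> lam b = ennreal (lam\<^sup>2 * bias_form M x ?R lam b b + c)" .
  qed
qed

section \<open>Averaging over eigenspaces\<close>

text \<open>\<open>(v j \<bullet> \<beta>)\<^sup>2\<close> is a linear function of \<open>outer \<beta>\<close>, hence its mean is that function of the mean.\<close>
lemma second_moment_spectral:
  fixes P :: "(real^'d) measure"
  assumes int: "integrable P outer"
    and mom: "(\<integral>\<beta>. outer \<beta> \<partial>P) = r *\<^sub>R spectral_fun \<Phi> \<tau> v" and orth: "orthonormal_family v"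
  shows "integrable P (\<lambda>\<beta>. (v j \<bullet> \<beta>)\<^sup>2)" and "(\<integral>\<beta>. (v j \<bullet> \<beta>)\<^sup>2 \<partial>P) = r * \<Phi> (\<tau> j)"
proof -
  let ?q = "\<lambda>A::real^'d^'d. v j \<bullet> (A *v v j)"
  have "linear ?q"
    by (intro linearI) (simp_all add: matrix_vector_mult_add_rdistrib inner_add_right
        scaleR_matrix_vector_assoc[symmetric])
  then have q: "bounded_linear ?q" by (simp add: linear_conv_bounded_linear)
  have qo: "?q (outer \<beta>) = (v j \<bullet> \<beta>)\<^sup>2" for \<beta>
    by (simp add: outer_mult_vec power2_eq_square inner_commute)
  show "integrable P (\<lambda>\<beta>. (v j \<bullet> \<beta>)\<^sup>2)"
    using integrable_bounded_linear[OF q int] by (simp add: qo)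
  have "(\<integral>\<beta>. (v j \<bullet> \<beta>)\<^sup>2 \<partial>P) = ?q (\<integral>\<beta>. outer \<beta> \<partial>P)"
    using integral_bounded_linear[OF q int] by (simp add: qo)
  also have "\<dots> = r * \<Phi> (\<tau> j)"
    using orth by (simp add: mom scaleR_matrix_vector_assoc[symmetric] spectral_fun_eigvec
        orthonormal_family_def)
  finally show "(\<integral>\<beta>. (v j \<bullet> \<beta>)\<^sup>2 \<partial>P) = r * \<Phi> (\<tau> j)" .
qed

text \<open>Averaging over the fibers of \<open>\<tau>\<close> is a symmetric operation, so it can be moved from \<open>f\<close> to \<open>a\<close>, which
  it fixes.\<close>
lemma sum_mult_fiber_average:
  fixes a f :: "'i::finite \<Rightarrow> real"
  assumes "\<And>j k. \<tau> j = \<tau> k \<Longrightarrow> a j = a k"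
  shows "(\<Sum>j\<in>UNIV. a j * ((\<Sum>k | \<tau> k = \<tau> j. f k) / real (card {k. \<tau> k = \<tau> j}))) = (\<Sum>k\<in>UNIV. a k * f k)"
proof -
  let ?J = "\<lambda>j. {k. \<tau> k = \<tau> j}"
  have "a j * ((\<Sum>k\<in>?J j. f k) / real (card (?J j))) = (\<Sum>k\<in>?J j. a k * f k / real (card (?J k)))" for j
    unfolding sum_distrib_left sum_divide_distrib
  proof (rule sum.cong[OF refl])
    fix k assume "k \<in> ?J j"
    then have k: "\<tau> k = \<tau> j" by simp
    show "a j * (f k / real (card (?J j))) = a k * f k / real (card (?J k))"
      by (simp add: k assms[OF k])
  qed
  then have "(\<Sum>j\<in>UNIV. a j * ((\<Sum>k\<in>?J j. f k) / real (card (?J j))))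
      = (\<Sum>j\<in>UNIV. \<Sum>k\<in>?J j. a k * f k / real (card (?J k)))" by simp
  also have "\<dots> = (\<Sum>j\<in>UNIV. \<Sum>k\<in>UNIV. if \<tau> k = \<tau> j then a k * f k / real (card (?J k)) else 0)"
    by (simp add: sum.If_cases Int_def)
  also have "\<dots> = (\<Sum>k\<in>UNIV. \<Sum>j\<in>UNIV. if \<tau> k = \<tau> j then a k * f k / real (card (?J k)) else 0)"
    by (rule sum.swap)
  also have "\<dots> = (\<Sum>k\<in>UNIV. real (card (?J k)) * (a k * f k / real (card (?J k))))"
  proof -
    have "{j. \<tau> k = \<tau> j} = ?J k" for k by auto
    then show ?thesis by (simp add: sum.If_cases Int_def)
  qed
  also have "\<dots> = (\<Sum>k\<in>UNIV. a k * f k)"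
  proof (rule sum.cong[OF refl])
    fix k
    have "card (?J k) \<noteq> 0" by (auto simp: card_eq_0_iff)
    then show "real (card (?J k)) * (a k * f k / real (card (?J k))) = a k * f k" by simp
  qed
  finally show ?thesis .
qed

theorem proposition1:
  fixes M :: "'w measure"
    and x :: "'n::finite \<Rightarrow> 'w \<Rightarrow> real^'d::finite"
    and \<epsilon> :: "'n \<Rightarrow> 'w \<Rightarrow> real"
    and S :: "real^'d^'d" and \<tau> :: "'d \<Rightarrow> real" and v :: "'d \<Rightarrow> real^'d"
    and lam \<sigma> :: real and \<beta>star :: "real^'d" and \<Phi> :: "real \<Rightarrow> real"
    and P :: "(real^'d) measure"
  assumes "0 < lam" and "0 < \<sigma>\<^sup>2"
    and "pos_semidef S"
    and "orthonormal_family v" and "\<And>j. S *v v j = \<tau> j *\<^sub>R v j"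
    (* the data *)
    and "prob_space M"
    and "prob_space.indep_vars M (\<lambda>_. borel) (\<lambda>i \<omega>. (x i \<omega>, \<epsilon> i \<omega>)) UNIV"
    and "\<And>i k. distr M borel (\<lambda>\<omega>. (x i \<omega>, \<epsilon> i \<omega>)) = distr M borel (\<lambda>\<omega>. (x k \<omega>, \<epsilon> k \<omega>))"
    and "\<And>i. distr M borel (x i) = gaussian S"
    and "\<And>i. integrable M (\<epsilon> i)" and "\<And>i. integrable M (\<lambda>\<omega>. (\<epsilon> i \<omega>)\<^sup>2)"
    and "\<And>i. AE \<omega> in M. real_cond_exp M (vimage_algebra (space M) (x i) borel) (\<epsilon> i) \<omega> = 0"
    and "\<And>i. AE \<omega> in M. real_cond_exp M (vimage_algebra (space M) (x i) borel)
                             (\<lambda>\<omega>. (\<epsilon> i \<omega>)\<^sup>2) \<omega> = 1"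
    (* the function \<Phi> *)
    and "\<And>t. t \<in> range \<tau> \<Longrightarrow>
           \<Phi> t = real CARD('d) / real (card {j. \<tau> j = t}) * (\<Sum>j | \<tau> j = t. (\<beta>star \<bullet> v j)\<^sup>2)"
    (* the prior \<Pi> *)
    and "prob_space P" and "sets P = sets borel"
    and "integrable P (\<lambda>\<beta>. \<beta>)" and "integrable P outer"
    and "(\<integral>\<beta>. \<beta> \<partial>P) = 0"
    and "(\<integral>\<beta>. outer \<beta> \<partial>P) = (1 / real CARD('d)) *\<^sub>R spectral_fun \<Phi> \<tau> v"
  shows "ridge_risk M x \<epsilon> S \<sigma> lam \<beta>star = (\<integral>\<^sup>+\<beta>. ridge_risk M x \<epsilon> S \<sigma> lam \<beta> \<partial>P)"
proof -
  note lam = assms(1) and psd = assms(3) and orth = assms(4) and eig = assms(5)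
    and M = assms(6) and indep = assms(7) and law = assms(9) and \<Phi> = assms(14)
  interpret M: prob_space M by fact
  interpret P: prob_space P by fact
  have indep_x: "M.indep_vars (\<lambda>_. borel) x UNIV"
  proof -
    have "M.indep_vars (\<lambda>_. borel) (\<lambda>i \<omega>. fst (x i \<omega>, \<epsilon> i \<omega>)) UNIV"
      by (rule M.indep_vars_compose2[OF indep])
        (intro borel_measurable_continuous_onI continuous_intros)
    then show ?thesis by simp
  qed
  then have x: "x i \<in> borel_measurable M" for i by (auto simp: M.indep_vars_def)
  let ?B = "bias_form M x (mat_sqrt S) lam"
  define a where "a j = ?B (v j) (v j)" for j
  note form = bias_form_eigenvectors[OF M lam indep_x law psd orth eig]
  have B_diag: "?B b b = (\<Sum>j\<in>UNIV. a j * (v j \<bullet> b)\<^sup>2)" for b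
  proof -
    have "?B b b = ?B (\<Sum>j\<in>UNIV. (v j \<bullet> b) *\<^sub>R v j) (\<Sum>j\<in>UNIV. (v j \<bullet> b) *\<^sub>R v j)"
      by (simp only: orthonormal_expand[OF orth])
    also have "\<dots> = (\<Sum>j\<in>UNIV. \<Sum>k\<in>UNIV. (v j \<bullet> b) * (v k \<bullet> b) * ?B (v j) (v k))"
      by (rule bias_form_sum_scaleR[OF M lam x finite])
    also have "\<dots> = (\<Sum>j\<in>UNIV. \<Sum>k\<in>UNIV. if k = j then a j * (v j \<bullet> b)\<^sup>2 else 0)"
      by (intro sum.cong refl) (simp add: a_def form(1) power2_eq_square)
    finally show ?thesis by simp
  qed
  have B_nonneg: "0 \<le> ?B b b" for b by (simp add: bias_form_def)
  obtain c where c: "0 \<le> c"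
    and risk: "\<And>b. ridge_risk M x \<epsilon> S \<sigma> lam b = ennreal (lam\<^sup>2 * ?B b b + c)"
    using ridge_risk_eq[OF M lam indep assms(10,11,12) x] by metis
  note mom = second_moment_spectral[OF assms(18,20) orth]
  have int: "integrable P (\<lambda>\<beta>. ?B \<beta> \<beta>)" unfolding B_diag using mom(1) by simp
  have "(\<integral>\<beta>. ?B \<beta> \<beta> \<partial>P) = (\<Sum>j\<in>UNIV. a j * (1 / real CARD('d) * \<Phi> (\<tau> j)))"
    unfolding B_diag using mom by simp
  also have "\<dots> = (\<Sum>j\<in>UNIV. a j * ((\<Sum>k | \<tau> k = \<tau> j. (v k \<bullet> \<beta>star)\<^sup>2) / real (card {k. \<tau> k = \<tau> j})))"
  proof (intro sum.cong refl arg_cong2[where f = "(*)"])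
    show "1 / real CARD('d) * \<Phi> (\<tau> j)
        = (\<Sum>k | \<tau> k = \<tau> j. (v k \<bullet> \<beta>star)\<^sup>2) / real (card {k. \<tau> k = \<tau> j})" for j
      by (subst \<Phi>) (simp_all add: inner_commute[of \<beta>star])
  qed
  also have "\<dots> = ?B \<beta>star \<beta>star"
    unfolding B_diag
    by (rule sum_mult_fiber_average[where \<tau> = \<tau> and a = a and f = "\<lambda>k. (v k \<bullet> \<beta>star)\<^sup>2"])
      (unfold a_def, rule form(2))
  finally have mean: "(\<integral>\<beta>. ?B \<beta> \<beta> \<partial>P) = ?B \<beta>star \<beta>star" .
  have "(\<integral>\<^sup>+\<beta>. ridge_risk M x \<epsilon> S \<sigma> lam \<beta> \<partial>P) = ennreal (\<integral>\<beta>. lam\<^sup>2 * ?B \<beta> \<beta> + c \<partial>P)"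
    unfolding risk using int c B_nonneg by (intro nn_integral_eq_integral) auto
  also have "(\<integral>\<beta>. lam\<^sup>2 * ?B \<beta> \<beta> + c \<partial>P) = lam\<^sup>2 * ?B \<beta>star \<beta>star + c"
    using int by (simp add: mean P.prob_space)
  finally show ?thesis by (simp add: risk)
qed

end
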